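(* Let $a_1,a_2,b_1,b_2,\beta,\lambda,\mu\in\mathbb{C}$ with $\lambda\mu\neq 0$ and $\varepsilon_0:=a_1b_2-a_2b_1\neq 0$. For $x=(x^0,x^1,x^2,x^3)\in\mathbb{R}^4$ put $$L=\tfrac{\beta}{\sqrt2}\big[(\lambda\overline\mu+1)x^0+(\lambda\overline\mu-1)x^1+(\lambda+\overline\mu)x^2+i(\lambda-\overline\mu)x^3\big],$$ $$\psi=\begin{pmatrix} a_1e^{L}+a_2e^{-L} & \overline{b}_1e^{\overline L}+\overline b_2e^{-\overline L}\\ -b_1e^{L}-b_2e^{-L} & \overline a_1e^{\overline L}+\overline a_2e^{-\overline L}\end{pmatrix},\quad \Lambda=\begin{pmatrix}\lambda&0\\0&\mu\end{pmatrix},\quad J=-\psi\Lambda\psi^{-1},$$ and $$A_0=A_1=-\tfrac12\big[(\partial_0J)J^{-1}+(\partial_1J)J^{-1}\big],\quad A_2=-\tfrac12\big[(\partial_2J)J^{-1}-i(\partial_3J)J^{-1}\big],\quad A_3=iA_2.$$ Then the gauge fields satisfy the anti-self-dual Yang-Mills equations for the Minkowski metric and are traceless (gauge group $\mathrm{SL}(2,\mathbb{C})$); and the Lagrangian density is real-valued, well defined on $\mathbb{R}^4$, and equal to $$\mathrm{Tr}\,F_{\rho\sigma}F^{\rho\sigma}=8\,|\beta(\lambda-\mu)|^4|\varepsilon_0|^2\;\frac{2\varepsilon_1\widetilde\varepsilon_1\sinh^2X_1-2|\varepsilon_2|^2\sinh^2X_2-|\varepsilon_0|^2}{\big[(\varepsilon_1\widetilde\varepsilon_1)^{1/2}\cosh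 X_1+|\varepsilon_2|\cosh X_2\big]^4},$$ where $\varepsilon_1=|a_1|^2+|b_1|^2$, $\widetilde\varepsilon_1=|a_2|^2+|b_2|^2$, $\varepsilon_2=a_1\overline a_2+b_1\overline b_2$, $X_1=\overline L+L+\frac12\log(\varepsilon_1/\widetilde\varepsilon_1)$ and $X_2=\overline L-L+\frac12\log(\varepsilon_2/\overline\varepsilon_2)$. If $\varepsilon_2=0$, the part containing $X_2$ is removed and $$\mathrm{Tr}\,F_{\rho\sigma}F^{\rho\sigma}=8\,|\beta(\lambda-\mu)|^4(2\,\mathrm{sech}^2X-3\,\mathrm{sech}^4X),\qquad X=L+\overline L+\tfrac12\log\frac{|a_1|^2+|b_1|^2}{|a_2|^2+|b_2|^2}.$$
   Context: $\partial_\rho=\partial/\partial x^\rho$. $\mathbb{R}^4$ carries the Minkowski metric $ds^2=(dx^0)^2-(dx^1)^2-(dx^2)^2-(dx^3)^2$, used to raise indices; repeated indices are summed; $F_{\rho\sigma}=\partial_\rho A_\sigma-\partial_\sigma A_\rho+[A_\rho,A_\sigma]$; the gauge fields are $2\times2$ complex matrix valued. With $z=(x^0+x^1)/\sqrt2$, $\widetilde z=(x^0-x^1)/\sqrt2$, $w=(x^2+ix^3)/\sqrt2$, $\widetilde w=\overline w$ (so $ds^2=2(dz\,d\widetilde z-dw\,d\widetilde w)$), the anti-self-dual Yang-Mills equations are $F_{zw}=0$, $F_{\widetilde z\widetilde w}=0$, $F_{z\widetilde z}-F_{w\widetilde w}=0$, where the components are obtained by (complex-linear) change of coordinates from $F_{\rho\sigma}$.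 In these coordinates $L=\beta(\lambda\overline\mu z+\widetilde z+\lambda w+\overline\mu\,\widetilde w)$, and the gauge fields above are $A_z=-(\partial_zJ)J^{-1}$, $A_w=-(\partial_wJ)J^{-1}$, $A_{\widetilde z}=A_{\widetilde w}=0$.
   Formalization: The printed X_2 has a sign error that makes the density formula false for non-real ε_2; the theorem uses X_2 = L − \bar L + ½log(ε_2/\bar ε_2), with ½log(ε_2/\bar ε_2) taken as i·Arg ε_2, since other branches flip the sign of cosh X_2. *)

theory Defs
  imports "HOL-Analysis.Analysis"
begin

text \<open>Points of \<open>\<real>\<^sup>4\<close> are vectors indexed by the type \<open>4\<close>, whose elements are
  \<open>0, 1, 2, 3\<close> (with \<open>4 = 0\<close>), so the physical indices \<open>x\<^sup>0, \<dots>, x\<^sup>3\<close> are the type indices.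
  Do not build such vectors with the constant \<open>vector\<close>: it fills the components in the order
  \<open>1, 2, 3, 0\<close>.\<close>

type_synonym spacetime = "real ^ 4"
type_synonym cmat2 = "complex ^ 2 ^ 2"

definition mat2 :: "complex \<Rightarrow> complex \<Rightarrow> complex \<Rightarrow> complex \<Rightarrow> cmat2" where
  "mat2 p q r s = vector [vector [p, q], vector [r, s]]"

definition cmat2_scale :: "complex \<Rightarrow> cmat2 \<Rightarrow> cmat2" (infixr \<open>*m\<close> 75) where
  "c *m M = map_matrix ((*) c) M"

definition partial :: "4 \<Rightarrow> (spacetime \<Rightarrow> 'a::real_normed_vector) \<Rightarrow> spacetime \<Rightarrow> 'a" where
  "partial \<rho> f x = vector_derivative (\<lambda>t. f (x + t *\<^sub>R axis \<rho> 1)) (at 0)"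

section \<open>Gauge fields on Minkowski space\<close>

text \<open>A gauge field is the family \<open>A \<rho>\<close> of its components.\<close>

definition field_strength ::
  "(4 \<Rightarrow> spacetime \<Rightarrow> cmat2) \<Rightarrow> 4 \<Rightarrow> 4 \<Rightarrow> spacetime \<Rightarrow> cmat2" where
  "field_strength A \<rho> \<sigma> x =
     partial \<rho> (A \<sigma>) x - partial \<sigma> (A \<rho>) x + (A \<rho> x ** A \<sigma> x - A \<sigma> x ** A \<rho> x)"

text \<open>The matrix \<open>diag(1,-1,-1,-1)\<close> is its own inverse, so it also gives the components
  with upper indices.\<close>

definition minkowski :: "4 \<Rightarrow> 4 \<Rightarrow> complex" where
  "minkowski \<rho> \<sigma> = (if \<rho> \<noteq> \<sigma> then 0 else if \<rho> = 0 then 1 else - 1)"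

definition field_strength_up ::
  "(4 \<Rightarrow> spacetime \<Rightarrow> cmat2) \<Rightarrow> 4 \<Rightarrow> 4 \<Rightarrow> spacetime \<Rightarrow> cmat2" where
  "field_strength_up A \<rho> \<sigma> x =
     (\<Sum>\<kappa>\<in>UNIV. \<Sum>\<tau>\<in>UNIV. (minkowski \<rho> \<kappa> * minkowski \<sigma> \<tau>) *m field_strength A \<kappa> \<tau> x)"

definition lagrangian :: "(4 \<Rightarrow> spacetime \<Rightarrow> cmat2) \<Rightarrow> spacetime \<Rightarrow> complex" where
  "lagrangian A x =
     (\<Sum>\<rho>\<in>UNIV. \<Sum>\<sigma>\<in>UNIV. trace (field_strength A \<rho> \<sigma> x ** field_strength_up A \<rho> \<sigma> x))"

text \<open>The coordinate vector fields of \<open>z, zt, w, wt\<close> in terms of \<open>\<partial>\<^sub>0, \<dots>, \<partial>\<^sub>3\<close>, obtained from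
  \<open>x\<^sup>0 = (z + zt)/\<surd>2\<close>, \<open>x\<^sup>1 = (z - zt)/\<surd>2\<close>, \<open>x\<^sup>2 = (w + wt)/\<surd>2\<close>, \<open>x\<^sup>3 = (w - wt)/(i\<surd>2)\<close>;
  the suffix \<open>t\<close> stands for the tilde.\<close>

definition cvec4 :: "complex \<Rightarrow> complex \<Rightarrow> complex \<Rightarrow> complex \<Rightarrow> complex ^ 4" where
  "cvec4 v0 v1 v2 v3 =
     (\<chi> \<rho>. if \<rho> = 0 then v0 else if \<rho> = 1 then v1 else if \<rho> = 2 then v2 else v3)"

definition dz :: "complex ^ 4" where
  "dz = cvec4 (1 / of_real (sqrt 2)) (1 / of_real (sqrt 2)) 0 0"
definition dzt :: "complex ^ 4" where
  "dzt = cvec4 (1 / of_real (sqrt 2)) (- 1 / of_real (sqrt 2)) 0 0"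
definition dw :: "complex ^ 4" where
  "dw = cvec4 0 0 (1 / of_real (sqrt 2)) (- \<i> / of_real (sqrt 2))"
definition dwt :: "complex ^ 4" where
  "dwt = cvec4 0 0 (1 / of_real (sqrt 2)) (\<i> / of_real (sqrt 2))"

definition field_strength_along ::
  "(4 \<Rightarrow> spacetime \<Rightarrow> cmat2) \<Rightarrow> complex ^ 4 \<Rightarrow> complex ^ 4 \<Rightarrow> spacetime \<Rightarrow> cmat2" where
  "field_strength_along A u v x =
     (\<Sum>\<rho>\<in>UNIV. \<Sum>\<sigma>\<in>UNIV. (u $ \<rho> * v $ \<sigma>) *m field_strength A \<rho> \<sigma> x)"

definition anti_self_dual_YM :: "(4 \<Rightarrow> spacetime \<Rightarrow> cmat2) \<Rightarrow> bool" where
  "anti_self_dual_YM A \<longleftrightarrow> (\<forall>x.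
     field_strength_along A dz dw x = 0 \<and>
     field_strength_along A dzt dwt x = 0 \<and>
     field_strength_along A dz dzt x - field_strength_along A dw dwt x = 0)"

section \<open>The one-soliton\<close>

definition Lfun :: "complex \<Rightarrow> complex \<Rightarrow> complex \<Rightarrow> spacetime \<Rightarrow> complex" where
  "Lfun \<beta> lam mu x = \<beta> / of_real (sqrt 2) *
     ((lam * cnj mu + 1) * of_real (x $ 0) + (lam * cnj mu - 1) * of_real (x $ 1)
      + (lam + cnj mu) * of_real (x $ 2) + \<i> * (lam - cnj mu) * of_real (x $ 3))"

definition psi :: "complex \<Rightarrow> complex \<Rightarrow> complex \<Rightarrow> complex \<Rightarrow> complex \<Rightarrow> complex \<Rightarrow> complex \<Rightarrow>
    spacetime \<Rightarrow> cmat2" where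
  "psi a1 a2 b1 b2 \<beta> lam mu x = (let L = Lfun \<beta> lam mu x in
     mat2 (a1 * exp L + a2 * exp (- L)) (cnj b1 * exp (cnj L) + cnj b2 * exp (- cnj L))
          (- b1 * exp L - b2 * exp (- L)) (cnj a1 * exp (cnj L) + cnj a2 * exp (- cnj L)))"

definition Jfun :: "complex \<Rightarrow> complex \<Rightarrow> complex \<Rightarrow> complex \<Rightarrow> complex \<Rightarrow> complex \<Rightarrow> complex \<Rightarrow>
    spacetime \<Rightarrow> cmat2" where
  "Jfun a1 a2 b1 b2 \<beta> lam mu x =
     - (psi a1 a2 b1 b2 \<beta> lam mu x ** mat2 lam 0 0 mu
        ** matrix_inv (psi a1 a2 b1 b2 \<beta> lam mu x))"

text \<open>The gauge field of a matrix function \<open>J\<close>; it is \<open>A\<^sub>z = -(\<partial>\<^sub>z J) J\<^sup>-\<^sup>1\<close>, \<open>A\<^sub>w = -(\<partial>\<^sub>w J) J\<^sup>-\<^sup>1\<close>,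
  with vanishing components along \<open>zt\<close> and \<open>wt\<close>.\<close>

definition gauge_field :: "(spacetime \<Rightarrow> cmat2) \<Rightarrow> 4 \<Rightarrow> spacetime \<Rightarrow> cmat2" where
  "gauge_field J \<rho> x =
     (let D = (\<lambda>\<sigma>. partial \<sigma> J x ** matrix_inv (J x));
          A01 = (- 1 / 2) *m (D 0 + D 1);
          A2 = (- 1 / 2) *m (D 2 - \<i> *m D 3)
      in if \<rho> = 0 \<or> \<rho> = 1 then A01 else if \<rho> = 2 then A2 else \<i> *m A2)"

section \<open>Quantities in the Lagrangian density\<close>

definition eps0 :: "complex \<Rightarrow> complex \<Rightarrow> complex \<Rightarrow> complex \<Rightarrow> complex" where
  "eps0 a1 a2 b1 b2 = a1 * b2 - a2 * b1"

definition eps1 :: "complex \<Rightarrow> complex \<Rightarrow> real" where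
  "eps1 a b = (cmod a)\<^sup>2 + (cmod b)\<^sup>2"

definition eps2 :: "complex \<Rightarrow> complex \<Rightarrow> complex \<Rightarrow> complex \<Rightarrow> complex" where
  "eps2 a1 a2 b1 b2 = a1 * cnj a2 + b1 * cnj b2"

text \<open>The logarithm of the unimodular number \<open>e / cnj e\<close> enters through half of it, and
  adding \<open>2\<pi>i\<close> to it changes the sign of \<open>cosh X\<^sub>2\<close>. The value needed is twice the phase of \<open>e\<close>;
  the principal value \<open>Ln (e / cnj e)\<close> differs from it, for instance, when \<open>Re e < 0\<close>.\<close>

definition log_ratio_cnj :: "complex \<Rightarrow> complex" where
  "log_ratio_cnj e = 2 * \<i> * of_real (Arg e)"

lemma exp_log_ratio_cnj:
  assumes "e \<noteq> 0"
  shows "exp (log_ratio_cnj e) = e / cnj e" "exp (log_ratio_cnj e / 2) = e / of_real (cmod e)"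
proof -
  have h: "exp (\<i> * of_real (Arg e)) = e / of_real (cmod e)"
    using assms Arg_eq[of e] by (simp add: field_simps)
  then show "exp (log_ratio_cnj e / 2) = e / of_real (cmod e)"
    by (simp add: log_ratio_cnj_def)
  have "exp (log_ratio_cnj e) = (exp (\<i> * of_real (Arg e)))\<^sup>2"
    by (simp add: log_ratio_cnj_def exp_double[symmetric] mult.assoc)
  also have "\<dots> = e\<^sup>2 / (e * cnj e)"
    by (simp add: h power_divide complex_norm_square[symmetric])
  finally show "exp (log_ratio_cnj e) = e / cnj e"
    using assms by (simp add: power2_eq_square)
qed

definition X1fun :: "complex \<Rightarrow> complex \<Rightarrow> complex \<Rightarrow> complex \<Rightarrow> complex \<Rightarrow> complex \<Rightarrow> complex \<Rightarrow>
    spacetime \<Rightarrow> complex" where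
  "X1fun a1 a2 b1 b2 \<beta> lam mu x =
     cnj (Lfun \<beta> lam mu x) + Lfun \<beta> lam mu x + of_real (ln (eps1 a1 b1 / eps1 a2 b2) / 2)"

text \<open>The sign of \<open>L - cnj L\<close> relative to the logarithm is fixed by
  \<open>det \<psi> = eps1 a1 b1 * exp (L + cnj L) + eps1 a2 b2 * exp (- L - cnj L)
  + eps2 * exp (L - cnj L) + cnj eps2 * exp (cnj L - L)\<close>, which has to equal
  \<open>2 (sqrt (eps1 a1 b1 * eps1 a2 b2) * cosh X\<^sub>1 + \<bar>eps2\<bar> * cosh X\<^sub>2)\<close>.
  The source prints \<open>cnj L - L\<close> here, for which the formula for the Lagrangian density fails
  in general when \<open>eps2\<close> is not real.\<close>

definition X2fun :: "complex \<Rightarrow> complex \<Rightarrow> complex \<Rightarrow> complex \<Rightarrow> complex \<Rightarrow> complex \<Rightarrow> complex \<Rightarrow>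
    spacetime \<Rightarrow> complex" where
  "X2fun a1 a2 b1 b2 \<beta> lam mu x =
     Lfun \<beta> lam mu x - cnj (Lfun \<beta> lam mu x) + log_ratio_cnj (eps2 a1 a2 b1 b2) / 2"

definition sech :: "complex \<Rightarrow> complex" where
  "sech u = 1 / cosh u"

end

theory Submission
  imports Defs
begin

text \<open>With \<open>u = a\<^sub>1 e\<^sup>L + a\<^sub>2 e\<^sup>-\<^sup>L\<close> and \<open>v = b\<^sub>1 e\<^sup>L + b\<^sub>2 e\<^sup>-\<^sup>L\<close>, \<open>J\<close> equals \<open>-(mu + (lam - mu) P)\<close>,
  where \<open>P\<close> is the orthogonal projection onto the line of \<open>(u, -v)\<close>. This vector depends on \<open>L\<close>
  only and \<open>u' v - u v' = 2 \<epsilon>\<^sub>0\<close>, so \<open>S = \<partial>P/\<partial>L\<close> and \<open>T = \<partial>P/\<partial>(cnj L)\<close> are nilpotent, \<open>\<partial>S/\<partial>L\<close>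
  is a multiple of \<open>S\<close>, \<open>\<partial>T/\<partial>(cnj L)\<close> is a multiple of \<open>T\<close>, and the mixed second derivative
  of \<open>P\<close> is the commutator \<open>M = [S, T]\<close>. Each \<open>A\<^sub>\<rho>\<close> is a combination of \<open>S\<close> and \<open>T\<close> with constant
  coefficients, hence \<open>F\<^sub>\<rho>\<^sub>\<sigma>\<close> is a combination of \<open>\<partial>S/\<partial>L\<close>, \<open>M\<close> and \<open>\<partial>T/\<partial>(cnj L)\<close> with constant
  coefficients. Anti-self-duality and the contraction in the Lagrangian are thereby
  identities between these constants; the remaining traces involve only \<open>D = det \<psi> = |u|\<^sup>2 + |v|\<^sup>2\<close>
  and \<open>\<partial>D/\<partial>L\<close>, which are twice the sums of the \<open>cosh\<close> and of the \<open>sinh\<close> terms.\<close>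

section \<open>Entries, traces and inverses of two-by-two matrices\<close>

lemma mat2_nth [simp]:
  "mat2 p q r s $ 1 $ 1 = p" "mat2 p q r s $ 1 $ 2 = q"
  "mat2 p q r s $ 2 $ 1 = r" "mat2 p q r s $ 2 $ 2 = s"
  by (simp_all add: mat2_def)

lemma cmat2_eq_iff:
  "(M::cmat2) = N \<longleftrightarrow> M$1$1 = N$1$1 \<and> M$1$2 = N$1$2 \<and> M$2$1 = N$2$1 \<and> M$2$2 = N$2$2"
  by (auto simp: vec_eq_iff forall_2)

lemma cmat2_scale_nth [simp]: "(c *m M) $ i $ j = c * M $ i $ j"
  by (simp add: cmat2_scale_def map_matrix_def)

lemma cmat2_mult_nth: "((M::cmat2) ** N) $ i $ j = M$i$1 * N$1$j + M$i$2 * N$2$j"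
  by (simp add: matrix_matrix_mult_def sum_2)

lemmas cmat2_simps = cmat2_eq_iff cmat2_mult_nth

lemma trace_cmat2: "trace (M::cmat2) = M$1$1 + M$2$2"
  by (simp add: trace_def sum_2)

lemma mat_1_nth [simp]: "(mat 1::cmat2) $ 1 $ 1 = 1" "(mat 1::cmat2) $ 1 $ 2 = 0"
  "(mat 1::cmat2) $ 2 $ 1 = 0" "(mat 1::cmat2) $ 2 $ 2 = 1"
  by (simp_all add: mat_def)

text \<open>For square matrices a right inverse is two-sided and unique, so the choice made by
  \<open>matrix_inv\<close> can only return \<open>N\<close>.\<close>

lemma cmat2_inverseI:
  fixes M N :: cmat2
  assumes "M ** N = mat 1"
  shows "invertible M" "matrix_inv M = N"
proof -
  have "N ** M = mat 1" using assms matrix_left_right_inverse by blast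
  with assms show i: "invertible M" by (auto simp: invertible_def)
  have "matrix_inv M ** M = mat 1"
    unfolding matrix_inv_def using someI_ex[OF i[unfolded invertible_def]] by blast
  then show "matrix_inv M = N"
    by (metis assms matrix_mul_assoc matrix_mul_lid matrix_mul_rid)
qed

section \<open>Differentiation of matrix-valued functions on spacetime\<close>

lemma bounded_linear_mat2:
  "bounded_linear (\<lambda>p. mat2 p 0 0 0)" "bounded_linear (\<lambda>p. mat2 0 p 0 0)"
  "bounded_linear (\<lambda>p. mat2 0 0 p 0)" "bounded_linear (\<lambda>p. mat2 0 0 0 p)"
  by (auto intro!: linear_conv_bounded_linear[THEN iffD1] linearI simp: cmat2_eq_iff)

text \<open>Each summand is a bounded linear image of one entry, which reduces differentiation of a
  matrix to its entries.\<close>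

lemma mat2_sum: "mat2 p q r s = mat2 p 0 0 0 + mat2 0 q 0 0 + mat2 0 0 r 0 + mat2 0 0 0 s"
  by (simp add: cmat2_eq_iff)

lemma has_derivative_mat2:
  assumes "(p has_derivative p') F" "(q has_derivative q') F"
    "(r has_derivative r') F" "(s has_derivative s') F"
  shows "((\<lambda>x. mat2 (p x) (q x) (r x) (s x)) has_derivative
          (\<lambda>h. mat2 (p' h) (q' h) (r' h) (s' h))) F"
  unfolding mat2_sum[of "p _" "q _" "r _" "s _"] mat2_sum[of "p' _" "q' _" "r' _" "s' _"]
  by (intro has_derivative_add bounded_linear.has_derivative[OF bounded_linear_mat2(1)]
      bounded_linear.has_derivative[OF bounded_linear_mat2(2)]
      bounded_linear.has_derivative[OF bounded_linear_mat2(3)]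
      bounded_linear.has_derivative[OF bounded_linear_mat2(4)] assms)

lemma has_derivative_cmat2_scale:
  assumes "(f has_derivative f') F"
  shows "((\<lambda>x. c *m f x) has_derivative (\<lambda>h. c *m f' h)) F"
  by (rule bounded_linear.has_derivative[OF _ assms])
    (auto intro!: linear_conv_bounded_linear[THEN iffD1] linearI simp: cmat2_eq_iff algebra_simps)

lemma partial_has_derivative:
  assumes "(f has_derivative f') (at x)"
  shows "partial \<rho> f x = f' (axis \<rho> 1)"
proof -
  have g: "((\<lambda>t::real. x + t *\<^sub>R axis \<rho> 1) has_derivative (\<lambda>t. t *\<^sub>R axis \<rho> 1)) (at 0)"
    by (auto intro!: derivative_eq_intros)
  have "((\<lambda>t::real. f (x + t *\<^sub>R axis \<rho> 1)) has_derivative (\<lambda>t. f' (t *\<^sub>R axis \<rho> 1))) (at 0)"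
    using has_derivative_compose[OF g, of f f'] assms by simp
  moreover have "(\<lambda>t. f' (t *\<^sub>R axis \<rho> 1)) = (\<lambda>t. t *\<^sub>R f' (axis \<rho> 1))"
    using assms by (simp add: has_derivative_linear linear_cmul)
  ultimately show ?thesis
    by (simp add: partial_def has_vector_derivative_def vector_derivative_at)
qed

text \<open>The index type is enumerated as 1, 2, 3, 4, and its element 4 is the time index
  0.\<close>

lemma sum_4_from_0: "sum f (UNIV::4 set) = f 0 + f 1 + f 2 + f 3"
proof -
  have "(4::4) = 0" by simp
  show ?thesis unfolding sum_4 \<open>4 = 0\<close> by (simp only: add_ac)
qed

lemma all_4_from_0: "(\<forall>\<rho>::4. Q \<rho>) \<longleftrightarrow> Q 0 \<and> Q 1 \<and> Q 2 \<and> Q 3"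
proof -
  have "(4::4) = 0" by simp
  show ?thesis unfolding forall_4 \<open>4 = 0\<close> by blast
qed

text \<open>Being real-linear, \<open>Lfun\<close> is its own derivative; its partial derivatives
  are the constants \<open>l \<rho>\<close> introduced below.\<close>

lemma bounded_linear_Lfun: "bounded_linear (Lfun \<beta> lam mu)"
  by (auto intro!: linear_conv_bounded_linear[THEN iffD1] linearI
      simp: Lfun_def algebra_simps scaleR_conv_of_real[where 'a = complex] add_divide_distrib)

lemma has_derivative_exp_compose:
  fixes f :: "'a::real_normed_vector \<Rightarrow> complex"
  assumes "(f has_derivative f') (at x)"
  shows "((\<lambda>x. exp (f x)) has_derivative (\<lambda>h. exp (f x) * f' h)) (at x)"
  using has_derivative_compose[OF assms, of exp "(*) (exp (f x))"] DERIV_exp[of "f x"]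
  by (simp add: has_field_derivative_def)

lemmas has_derivative_Lfun = bounded_linear_imp_has_derivative[OF bounded_linear_Lfun]

section \<open>The functions \<open>u\<close>, \<open>v\<close> and the determinant
  \<open>D\<close>\<close>

locale soliton =
  fixes a1 a2 b1 b2 \<beta> lam mu :: complex
  assumes lam: "lam \<noteq> 0" and mu: "mu \<noteq> 0"
    and eps0: "eps0 a1 a2 b1 b2 \<noteq> 0"
begin

abbreviation "k \<equiv> lam - mu"
abbreviation "e0 \<equiv> eps0 a1 a2 b1 b2"
abbreviation "L \<equiv> Lfun \<beta> lam mu"
abbreviation "l \<rho> \<equiv> L (axis \<rho> 1)"
definition "u x = a1 * exp (L x) + a2 * exp (- L x)"
definition "v x = b1 * exp (L x) + b2 * exp (- L x)"
definition "u' x = a1 * exp (L x) - a2 * exp (- L x)"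
definition "v' x = b1 * exp (L x) - b2 * exp (- L x)"
definition "D x = u x * cnj (u x) + v x * cnj (v x)"
definition "D' x = u' x * cnj (u x) + v' x * cnj (v x)"

text \<open>As functions of \<open>L\<close>, \<open>u\<close> and \<open>v\<close> both solve f'' =
  f, so their Wronskian is constant.\<close>

lemma wronskian: "u' x * v x - u x * v' x = 2 * e0"
proof -
  have "exp (L x) * exp (- L x) = 1" by (simp add: exp_minus)
  then show ?thesis unfolding u_def v_def u'_def v'_def eps0_def by algebra
qed

lemma wronskian_cnj: "cnj (u' x) * cnj (v x) - cnj (u x) * cnj (v' x) = 2 * cnj e0"
  using arg_cong[OF wronskian, of cnj x] by simp

lemma D_cmod: "D x = of_real ((cmod (u x))\<^sup>2 + (cmod (v x))\<^sup>2)"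
  by (simp add: D_def complex_norm_square del: of_real_power)

text \<open>\<open>D\<close> is a sum of two squared moduli; a zero of it would be a common zero of
  \<open>u\<close> and \<open>v\<close>, where the Wronskian would vanish.\<close>

lemma D_nonzero: "D x \<noteq> 0"
proof
  assume "D x = 0"
  then have "(cmod (u x))\<^sup>2 + (cmod (v x))\<^sup>2 = 0" by (simp only: D_cmod of_real_eq_0_iff)
  then have "u x = 0 \<and> v x = 0" by (simp add: add_nonneg_eq_0_iff)
  with wronskian[of x] eps0 show False by simp
qed

lemma has_derivative_u: "(u has_derivative (\<lambda>h. L h * u' x)) (at x)"
  unfolding u_def[abs_def] u'_def
  by (rule has_derivative_eq_rhs, (rule has_derivative_add has_derivative_mult_right has_derivative_minus has_derivative_exp_compose has_derivative_Lfun)+)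
    (simp add: algebra_simps)

lemma has_derivative_v: "(v has_derivative (\<lambda>h. L h * v' x)) (at x)"
  unfolding v_def[abs_def] v'_def
  by (rule has_derivative_eq_rhs, (rule has_derivative_add has_derivative_mult_right has_derivative_minus has_derivative_exp_compose has_derivative_Lfun)+)
    (simp add: algebra_simps)

lemma has_derivative_cnj_u: "((\<lambda>x. cnj (u x)) has_derivative (\<lambda>h. cnj (L h) * cnj (u' x))) (at x)"
  using bounded_linear.has_derivative[OF bounded_linear_cnj has_derivative_u] by simp

lemma has_derivative_cnj_v: "((\<lambda>x. cnj (v x)) has_derivative (\<lambda>h. cnj (L h) * cnj (v' x))) (at x)"
  using bounded_linear.has_derivative[OF bounded_linear_cnj has_derivative_v] by simp

lemmas has_derivative_uv =
  has_derivative_u has_derivative_v has_derivative_cnj_u has_derivative_cnj_v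

lemma has_derivative_D: "(D has_derivative (\<lambda>h. L h * D' x + cnj (L h) * cnj (D' x))) (at x)"
  unfolding D_def[abs_def] D'_def
  by (rule has_derivative_eq_rhs, (rule has_derivative_add has_derivative_mult has_derivative_uv)+)
    (simp add: algebra_simps)

section \<open>Quotients by powers of \<open>D\<close>; first and second derivatives of the
  projection\<close>

lemma has_derivative_div_D_power:
  assumes "(f has_derivative (\<lambda>h. L h * p + cnj (L h) * q)) (at x)"
  shows "((\<lambda>x. c * (f x / D x ^ Suc n)) has_derivative
     (\<lambda>h. L h * (c * (p * D x - of_nat (Suc n) * f x * D' x) / D x ^ Suc (Suc n))
        + cnj (L h) * (c * (q * D x - of_nat (Suc n) * f x * cnj (D' x)) / D x ^ Suc (Suc n)))) (at x)"
proof -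
  \<comment> \<open>The quotient rule with \<open>d = D x\<close> and \<open>E = D x ^ n\<close>: a
    factor \<open>E\<close> cancels, and the coefficients of \<open>L h\<close> and
    \<open>cnj (L h)\<close> separate.\<close>
  have alg: "c * (((l * p + l' * q) * (d * E) - f * (N * (l * d' + l' * d'') * E)) / (d * E * (d * E)))
      = l * (c * (p * d - N * f * d') / (d * (d * E))) + l' * (c * (q * d - N * f * d'') / (d * (d * E)))"
    if "d \<noteq> 0" "E \<noteq> 0" for l l' f d d' d'' E N :: complex
    using that by (simp add: divide_simps) (simp add: algebra_simps)
  note der = has_derivative_mult_right[OF has_derivative_divide'[OF assms
        has_derivative_power[OF has_derivative_D, of "Suc n"]]]
  show ?thesis
    by (rule has_derivative_eq_rhs[OF der], simp add: D_nonzero, rule ext)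
      (simp only: power_Suc diff_Suc_1, rule alg, simp_all add: D_nonzero)
qed

text \<open>The numerators \<open>r\<close> and \<open>s\<close> are parameters so that they can be
  supplied in the short form produced by the Wronskian.\<close>

lemma has_derivative_div_D:
  assumes "(f has_derivative (\<lambda>h. L h * p + cnj (L h) * q)) (at x)"
    and "p * D x - f x * D' x = r" and "q * D x - f x * cnj (D' x) = s"
  shows "((\<lambda>x. f x / D x) has_derivative (\<lambda>h. L h * (r / (D x)\<^sup>2) + cnj (L h) * (s / (D x)\<^sup>2))) (at x)"
  using has_derivative_div_D_power[OF assms(1), of 1 0] assms(2,3) by (simp add: power2_eq_square)

lemma has_derivative_div_D_square:
  assumes "(f has_derivative (\<lambda>h. L h * p + cnj (L h) * q)) (at x)"
    and "p * D x - 2 * f x * D' x = r" and "q * D x - 2 * f x * cnj (D' x) = s"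
  shows "((\<lambda>x. c * (f x / (D x)\<^sup>2)) has_derivative
    (\<lambda>h. L h * (c * r / (D x) ^ 3) + cnj (L h) * (c * s / (D x) ^ 3))) (at x)"
  using has_derivative_div_D_power[OF assms(1), of c 1] assms(2,3)
  by (simp add: power2_eq_square power3_eq_cube mult.assoc)

text \<open>\<open>S'\<close> and \<open>T'\<close> are the derivatives of \<open>S\<close> in \<open>L\<close> and of \<open>T\<close> in \<open>cnj L\<close>, whereas \<open>u'\<close>, \<open>v'\<close>, \<open>D'\<close>
  are derivatives in \<open>L\<close>; \<open>L\<close> and \<open>cnj L\<close> are treated as independent variables.\<close>

definition "P x = mat2 (u x * cnj (u x) / D x) (- u x * cnj (v x) / D x)
  (- v x * cnj (u x) / D x) (v x * cnj (v x) / D x)"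

definition "S x = mat2
  (2 * e0 * (cnj (u x) * cnj (v x) / (D x)\<^sup>2)) (2 * e0 * (- cnj (v x) * cnj (v x) / (D x)\<^sup>2))
  (2 * e0 * (cnj (u x) * cnj (u x) / (D x)\<^sup>2)) (2 * e0 * (- cnj (u x) * cnj (v x) / (D x)\<^sup>2))"

definition "T x = mat2
  (2 * cnj e0 * (u x * v x / (D x)\<^sup>2)) (2 * cnj e0 * (u x * u x / (D x)\<^sup>2))
  (2 * cnj e0 * (- v x * v x / (D x)\<^sup>2)) (2 * cnj e0 * (- u x * v x / (D x)\<^sup>2))"

definition "S' x = (- 2 * D' x / D x) *m S x"

definition "T' x = (- 2 * cnj (D' x) / D x) *m T x"

text \<open>This is 4 |\<open>e0\<close>|^2 / \<open>D\<close>^2 times the reflection 1 - 2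
  \<open>P\<close>.\<close>

definition "M x = (4 * e0 * cnj e0 / (D x) ^ 3) *m mat2
  (v x * cnj (v x) - u x * cnj (u x)) (2 * u x * cnj (v x))
  (2 * v x * cnj (u x)) (u x * cnj (u x) - v x * cnj (v x))"

text \<open>The quotient rule produces \<open>u' D - u D'\<close> and \<open>v' D - v D'\<close>,
  which by the Wronskian are \<open>2 e0 cnj v\<close> and \<open>- 2 e0 cnj u\<close>; the
  derivative in \<open>cnj L\<close> is the conjugate computation.\<close>

lemma has_derivative_P: "(P has_derivative (\<lambda>h. L h *m S x + cnj (L h) *m T x)) (at x)"
proof -
  note w = wronskian[of x] wronskian_cnj[of x] D_def[of x] D'_def[of x]
    arg_cong[OF D'_def[of x], of cnj, simplified]
  have 1: "((\<lambda>x. u x * cnj (u x) / D x) has_derivative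
     (\<lambda>h. L h * ((2 * e0 * (cnj (u x) * cnj (v x))) / (D x)\<^sup>2) + cnj (L h) * ((2 * cnj e0 * (u x * v x)) / (D x)\<^sup>2))) (at x)"
    \<comment> \<open>Here and below, \<open>p\<close> and \<open>q\<close> are the derivatives of
      the numerator in \<open>L\<close> and in \<open>cnj L\<close>.\<close>
    by (rule has_derivative_div_D[where p = "u' x * cnj (u x)" and q = "u x * cnj (u' x)"],
        rule has_derivative_eq_rhs, (rule has_derivative_mult has_derivative_uv)+,
        simp add: algebra_simps, (use w in algebra)+)
  have 2: "((\<lambda>x. - u x * cnj (v x) / D x) has_derivative
     (\<lambda>h. L h * ((2 * e0 * (- cnj (v x) * cnj (v x))) / (D x)\<^sup>2) + cnj (L h) * ((2 * cnj e0 * (u x * u x)) / (D x)\<^sup>2))) (at x)"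
    by (rule has_derivative_div_D[where p = "- u' x * cnj (v x)" and q = "- u x * cnj (v' x)"],
        rule has_derivative_eq_rhs, (rule has_derivative_mult has_derivative_minus has_derivative_uv)+,
        simp add: algebra_simps, (use w in algebra)+)
  have 3: "((\<lambda>x. - v x * cnj (u x) / D x) has_derivative
     (\<lambda>h. L h * ((2 * e0 * (cnj (u x) * cnj (u x))) / (D x)\<^sup>2) + cnj (L h) * ((2 * cnj e0 * (- v x * v x)) / (D x)\<^sup>2))) (at x)"
    by (rule has_derivative_div_D[where p = "- v' x * cnj (u x)" and q = "- v x * cnj (u' x)"],
        rule has_derivative_eq_rhs, (rule has_derivative_mult has_derivative_minus has_derivative_uv)+,
        simp add: algebra_simps, (use w in algebra)+)
  have 4: "((\<lambda>x. v x * cnj (v x) / D x) has_derivative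
     (\<lambda>h. L h * ((2 * e0 * (- cnj (u x) * cnj (v x))) / (D x)\<^sup>2) + cnj (L h) * ((2 * cnj e0 * (- u x * v x)) / (D x)\<^sup>2))) (at x)"
    by (rule has_derivative_div_D[where p = "v' x * cnj (v x)" and q = "v x * cnj (v' x)"],
        rule has_derivative_eq_rhs, (rule has_derivative_mult has_derivative_uv)+,
        simp add: algebra_simps, (use w in algebra)+)
  show ?thesis
    unfolding P_def[abs_def] S_def T_def
    by (rule has_derivative_eq_rhs[OF has_derivative_mat2[OF 1 2 3 4]])
      (simp add: fun_eq_iff cmat2_eq_iff)
qed

text \<open>The numerators of \<open>S\<close> contain only \<open>cnj (u x)\<close> and
  \<open>cnj (v x)\<close>. Hence \<open>p = 0\<close>, and in \<open>L\<close> only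
  \<open>1 / D^2\<close> varies, which gives \<open>S'\<close>; in \<open>cnj L\<close> the
  conjugate Wronskian gives \<open>M\<close>.\<close>

lemma has_derivative_S: "(S has_derivative (\<lambda>h. L h *m S' x + cnj (L h) *m M x)) (at x)"
proof -
  note w = wronskian_cnj[of x] D_def[of x] arg_cong[OF D'_def[of x], of cnj, simplified]
  let ?d = "\<lambda>f m. (\<lambda>h. L h * (2 * e0 * (- 2 * f * D' x) / (D x) ^ 3)
      + cnj (L h) * (2 * e0 * (2 * cnj e0 * m) / (D x) ^ 3))"
  have 1: "((\<lambda>x. 2 * e0 * (cnj (u x) * cnj (v x) / (D x)\<^sup>2)) has_derivative
      ?d (cnj (u x) * cnj (v x)) (v x * cnj (v x) - u x * cnj (u x))) (at x)"
    by (rule has_derivative_div_D_square[where p = 0 and q = "cnj (u' x) * cnj (v x) + cnj (u x) * cnj (v' x)"],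
        rule has_derivative_eq_rhs, (rule has_derivative_mult has_derivative_uv)+,
        simp add: algebra_simps, simp, (use w in algebra))
  have 2: "((\<lambda>x. 2 * e0 * (- cnj (v x) * cnj (v x) / (D x)\<^sup>2)) has_derivative
      ?d (- cnj (v x) * cnj (v x)) (2 * u x * cnj (v x))) (at x)"
    by (rule has_derivative_div_D_square[where p = 0 and q = "- 2 * cnj (v x) * cnj (v' x)"],
        rule has_derivative_eq_rhs, (rule has_derivative_mult has_derivative_minus has_derivative_uv)+,
        simp add: algebra_simps, simp, (use w in algebra))
  have 3: "((\<lambda>x. 2 * e0 * (cnj (u x) * cnj (u x) / (D x)\<^sup>2)) has_derivative
      ?d (cnj (u x) * cnj (u x)) (2 * v x * cnj (u x))) (at x)"
    by (rule has_derivative_div_D_square[where p = 0 and q = "2 * cnj (u x) * cnj (u' x)"],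
        rule has_derivative_eq_rhs, (rule has_derivative_mult has_derivative_uv)+,
        simp add: algebra_simps, simp, (use w in algebra))
  have 4: "((\<lambda>x. 2 * e0 * (- cnj (u x) * cnj (v x) / (D x)\<^sup>2)) has_derivative
      ?d (- cnj (u x) * cnj (v x)) (u x * cnj (u x) - v x * cnj (v x))) (at x)"
    by (rule has_derivative_div_D_square[where p = 0 and q = "- (cnj (u' x) * cnj (v x) + cnj (u x) * cnj (v' x))"],
        rule has_derivative_eq_rhs, (rule has_derivative_mult has_derivative_minus has_derivative_uv)+,
        simp add: algebra_simps, simp, (use w in algebra))
  show ?thesis
    unfolding S_def[abs_def] S'_def M_def
    by (rule has_derivative_eq_rhs[OF has_derivative_mat2[OF 1 2 3 4]])
      (simp add: fun_eq_iff cmat2_eq_iff power2_eq_square power3_eq_cube mult_ac)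
qed

text \<open>The roles of \<open>L\<close> and \<open>cnj L\<close> are exchanged. The same
  \<open>M\<close> appears, as symmetry of the second derivatives of \<open>P\<close>
  demands.\<close>

lemma has_derivative_T: "(T has_derivative (\<lambda>h. L h *m M x + cnj (L h) *m T' x)) (at x)"
proof -
  note w = wronskian[of x] D_def[of x] D'_def[of x]
  let ?d = "\<lambda>f m. (\<lambda>h. L h * (2 * cnj e0 * (2 * e0 * m) / (D x) ^ 3)
      + cnj (L h) * (2 * cnj e0 * (- 2 * f * cnj (D' x)) / (D x) ^ 3))"
  have 1: "((\<lambda>x. 2 * cnj e0 * (u x * v x / (D x)\<^sup>2)) has_derivative
      ?d (u x * v x) (v x * cnj (v x) - u x * cnj (u x))) (at x)"
    by (rule has_derivative_div_D_square[where q = 0 and p = "u' x * v x + u x * v' x"],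
        rule has_derivative_eq_rhs, (rule has_derivative_mult has_derivative_uv)+,
        simp add: algebra_simps, (use w in algebra), simp)
  have 2: "((\<lambda>x. 2 * cnj e0 * (u x * u x / (D x)\<^sup>2)) has_derivative
      ?d (u x * u x) (2 * u x * cnj (v x))) (at x)"
    by (rule has_derivative_div_D_square[where q = 0 and p = "2 * u x * u' x"],
        rule has_derivative_eq_rhs, (rule has_derivative_mult has_derivative_uv)+,
        simp add: algebra_simps, (use w in algebra), simp)
  have 3: "((\<lambda>x. 2 * cnj e0 * (- v x * v x / (D x)\<^sup>2)) has_derivative
      ?d (- v x * v x) (2 * v x * cnj (u x))) (at x)"
    by (rule has_derivative_div_D_square[where q = 0 and p = "- 2 * v x * v' x"],
        rule has_derivative_eq_rhs, (rule has_derivative_mult has_derivative_minus has_derivative_uv)+,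
        simp add: algebra_simps, (use w in algebra), simp)
  have 4: "((\<lambda>x. 2 * cnj e0 * (- u x * v x / (D x)\<^sup>2)) has_derivative
      ?d (- u x * v x) (u x * cnj (u x) - v x * cnj (v x))) (at x)"
    by (rule has_derivative_div_D_square[where q = 0 and p = "- (u' x * v x + u x * v' x)"],
        rule has_derivative_eq_rhs, (rule has_derivative_mult has_derivative_minus has_derivative_uv)+,
        simp add: algebra_simps, (use w in algebra), simp)
  show ?thesis
    unfolding T_def[abs_def] T'_def M_def
    by (rule has_derivative_eq_rhs[OF has_derivative_mat2[OF 1 2 3 4]])
      (simp add: fun_eq_iff cmat2_eq_iff power2_eq_square power3_eq_cube mult_ac)
qed

section \<open>Products of \<open>S\<close>, \<open>T\<close> and \<open>P\<close>\<close>

lemma cmod_e0: "e0 * cnj e0 = of_real ((cmod e0)\<^sup>2)"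
  by (simp add: complex_norm_square del: of_real_power)

text \<open>With the common factor 4 |\<open>e0\<close>|^2 / \<open>D\<close>^2,
  \<open>S ** T\<close> is a multiple of 1 - \<open>P\<close> and \<open>T ** S\<close> a multiple
  of \<open>P\<close>.\<close>

lemma S_mult_T_commutator: "S x ** T x - T x ** S x = M x"
  using D_nonzero[of x]
  by (simp add: S_def T_def M_def cmat2_simps field_simps power2_eq_square power3_eq_cube)
    (simp add: D_def algebra_simps)

text \<open>Up to a factor, \<open>S\<close> is the column (cnj v, cnj u) times the row (cnj u, -
  cnj v), and \<open>T\<close> is the column (u, - v) times the row (v, u). In both cases the row
  annihilates the column.\<close>

lemma S_mult_S: "S x ** S x = 0"
  by (simp add: S_def cmat2_simps algebra_simps)

lemma T_mult_T: "T x ** T x = 0"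
  by (simp add: T_def cmat2_simps algebra_simps)

text \<open>\<open>P\<close> is the column (u, - v) times the row (cnj u, - cnj v), divided by
  \<open>D\<close>. It shares its row with \<open>S\<close>, while the row of \<open>T\<close>
  annihilates its column.\<close>

lemma S_mult_P: "S x ** P x = S x"
  using D_nonzero[of x]
  by (simp add: S_def P_def cmat2_simps field_simps power2_eq_square)
    (simp add: D_def algebra_simps)

lemma T_mult_P: "T x ** P x = 0"
  by (simp add: T_def P_def cmat2_simps algebra_simps)

lemma P_mult_P: "P x ** P x = P x"
  using D_nonzero[of x]
  by (simp add: P_def cmat2_simps field_simps power2_eq_square)
    (simp add: D_def algebra_simps)

section \<open>The matrices \<open>\<psi>\<close> and \<open>J\<close> and the gauge field\<close>

abbreviation "\<psi> \<equiv> psi a1 a2 b1 b2 \<beta> lam mu"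
abbreviation "J \<equiv> Jfun a1 a2 b1 b2 \<beta> lam mu"
abbreviation "A \<equiv> gauge_field (Jfun a1 a2 b1 b2 \<beta> lam mu)"

lemma psi_eq: "\<psi> x = mat2 (u x) (cnj (v x)) (- v x) (cnj (u x))"
  by (simp add: psi_def Let_def u_def v_def exp_cnj cmat2_eq_iff)

text \<open>The inverse is the adjugate of \<open>\<psi> x\<close> divided by its determinant
  \<open>D x\<close>.\<close>

lemma psi_inverse:
  shows invertible_psi: "invertible (\<psi> x)"
    and matrix_inv_psi: "matrix_inv (\<psi> x) =
      mat2 (cnj (u x) / D x) (- cnj (v x) / D x) (v x / D x) (u x / D x)"
proof -
  have "\<psi> x ** mat2 (cnj (u x) / D x) (- cnj (v x) / D x) (v x / D x) (u x / D x) = mat 1"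
    using D_nonzero[of x]
    by (simp add: psi_eq cmat2_simps field_simps) (simp add: D_def algebra_simps)
  note i = cmat2_inverseI[OF this]
  show "invertible (\<psi> x)" "matrix_inv (\<psi> x) =
      mat2 (cnj (u x) / D x) (- cnj (v x) / D x) (v x / D x) (u x / D x)"
    by (fact i)+
qed

text \<open>The columns of \<open>\<psi> x\<close> are orthogonal eigenvectors of
  \<open>- J x\<close> for \<open>lam\<close> and \<open>mu\<close>, and \<open>P x\<close> projects
  onto the first.\<close>

lemma J_eq: "J x = - (mu *m mat 1 + k *m P x)"
  unfolding Jfun_def matrix_inv_psi unfolding psi_eq P_def
  using D_nonzero[of x]
  by (simp add: cmat2_simps field_simps)
    (simp add: D_def algebra_simps)

text \<open>\<open>J x\<close> acts as \<open>- lam\<close> on the image of \<open>P x\<close> and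
  as \<open>- mu\<close> on its kernel; both scalars are inverted.\<close>

lemma J_inverse:
  shows invertible_J: "invertible (J x)"
    and matrix_inv_J: "matrix_inv (J x) = - ((1 / mu) *m mat 1 + (1 / lam - 1 / mu) *m P x)"
proof -
  have expand: "(a *m mat 1 + b *m Q) ** (c *m mat 1 + d *m Q)
      = (a * c) *m mat 1 + (a * d + b * c) *m Q + (b * d) *m (Q ** Q)" for a b c d Q
    by (simp add: cmat2_simps algebra_simps)
  have neg: "(- X) ** (- Y) = X ** Y" for X Y :: cmat2
    by (simp add: cmat2_simps)
  have "J x ** - ((1 / mu) *m mat 1 + (1 / lam - 1 / mu) *m P x) = mat 1"
    unfolding J_eq neg expand P_mult_P
    using lam mu by (simp add: cmat2_eq_iff field_simps)
  note i = cmat2_inverseI[OF this]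
  show "invertible (J x)" "matrix_inv (J x) = - ((1 / mu) *m mat 1 + (1 / lam - 1 / mu) *m P x)"
    by (fact i)+
qed

lemma has_derivative_J: "(J has_derivative (\<lambda>h. - (k *m (L h *m S x + cnj (L h) *m T x)))) (at x)"
  unfolding J_eq[abs_def]
  by (rule has_derivative_eq_rhs,
      (rule has_derivative_minus has_derivative_add has_derivative_const
        has_derivative_cmat2_scale has_derivative_P)+) simp

text \<open>Since \<open>S\<close> absorbs \<open>P\<close> from the right, it meets the eigenvalue
  \<open>1 / lam\<close> of the inverse; \<open>T\<close> kills \<open>P\<close> and meets
  \<open>1 / mu\<close>.\<close>

lemma log_derivative_J:
  "partial \<rho> J x ** matrix_inv (J x) = k *m ((l \<rho> / lam) *m S x + (cnj (l \<rho>) / mu) *m T x)"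
proof -
  have expand: "- (k *m (a *m X + b *m Y)) ** - (c *m mat 1 + d *m Q)
      = k *m ((a * c) *m X + (b * c) *m Y + (a * d) *m (X ** Q) + (b * d) *m (Y ** Q))"
    for a b c d :: complex and X Y Q :: cmat2
    by (simp add: cmat2_simps algebra_simps)
  show ?thesis
    unfolding partial_has_derivative[OF has_derivative_J] matrix_inv_J expand S_mult_P T_mult_P
    using lam mu by (simp add: cmat2_eq_iff field_simps)
qed

lemma l_0: "l 0 = \<beta> / of_real (sqrt 2) * (lam * cnj mu + 1)"
  and l_1: "l 1 = \<beta> / of_real (sqrt 2) * (lam * cnj mu - 1)"
  and l_2: "l 2 = \<beta> / of_real (sqrt 2) * (lam + cnj mu)"
  and l_3: "l 3 = \<beta> / of_real (sqrt 2) * (\<i> * (lam - cnj mu))"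
  by (simp_all add: Lfun_def axis_def)

text \<open>In \<open>p'\<close>, \<open>q'\<close> and \<open>l'\<close> the prime marks no
  derivative, but a coefficient stripped of the factors common to all indices.\<close>

definition p' :: "4 \<Rightarrow> complex" where
  "p' \<rho> = (if \<rho> = 0 \<or> \<rho> = 1 then cnj mu else if \<rho> = 2 then 1 else \<i>)"

definition q' :: "4 \<Rightarrow> complex" where
  "q' \<rho> = (if \<rho> = 0 \<or> \<rho> = 1 then cnj lam else if \<rho> = 2 then 1 else \<i>)"

definition p :: "4 \<Rightarrow> complex" where
  "p \<rho> = - k * \<beta> / of_real (sqrt 2) * p' \<rho>"

definition q :: "4 \<Rightarrow> complex" where
  "q \<rho> = - k * cnj \<beta> / of_real (sqrt 2) * q' \<rho>"

text \<open>The denominators cancel: \<open>l 0 + l 1\<close> is a multiple of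
  \<open>lam * cnj mu\<close>, and \<open>l 2 - \<i> * l 3\<close> is a multiple of
  \<open>lam\<close>. The conjugated coefficients likewise contain \<open>mu\<close>.\<close>

lemma A_eq: "A \<rho> x = p \<rho> *m S x + q \<rho> *m T x"
  unfolding gauge_field_def Let_def log_derivative_J l_0 l_1 l_2 l_3 p_def q_def p'_def q'_def
  using lam mu
  by (cases "\<rho> = 0 \<or> \<rho> = 1"; cases "\<rho> = 2")
    (simp_all add: cmat2_simps divide_simps, simp_all add: algebra_simps)

section \<open>Field strength and anti-self-duality\<close>

lemma has_derivative_A:
  "(A \<rho> has_derivative (\<lambda>h. p \<rho> *m (L h *m S' x + cnj (L h) *m M x)
     + q \<rho> *m (L h *m M x + cnj (L h) *m T' x))) (at x)"
  unfolding A_eq[abs_def]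
  by (intro has_derivative_add has_derivative_cmat2_scale has_derivative_S has_derivative_T)

definition "fS \<rho> \<sigma> = l \<rho> * p \<sigma> - l \<sigma> * p \<rho>"
definition "fT \<rho> \<sigma> = cnj (l \<rho>) * q \<sigma> - cnj (l \<sigma>) * q \<rho>"
text \<open>\<open>M\<close> arises from \<open>S\<close> differentiated in \<open>cnj L\<close>,
  from \<open>T\<close> differentiated in \<open>L\<close>, and from the commutator of
  \<open>S\<close> and \<open>T\<close>; the terms come in this order.\<close>

definition "fM \<rho> \<sigma> = cnj (l \<rho>) * p \<sigma> - cnj (l \<sigma>) * p \<rho> + l \<rho> * q \<sigma> - l \<sigma> * q \<rho>
  + p \<rho> * q \<sigma> - q \<rho> * p \<sigma>"

lemma commutator_A: "A \<rho> x ** A \<sigma> x - A \<sigma> x ** A \<rho> x = (p \<rho> * q \<sigma> - q \<rho> * p \<sigma>) *m M x"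
  unfolding S_mult_T_commutator[symmetric]
  by (simp add: A_eq cmat2_simps algebra_simps)

lemma field_strength_eq:
  "field_strength A \<rho> \<sigma> x = fS \<rho> \<sigma> *m S' x + fM \<rho> \<sigma> *m M x + fT \<rho> \<sigma> *m T' x"
  unfolding field_strength_def commutator_A partial_has_derivative[OF has_derivative_A]
  by (simp add: fS_def fM_def fT_def cmat2_simps algebra_simps)

lemma field_strength_along_eq:
  "field_strength_along A a b x =
    (\<Sum>\<rho>\<in>UNIV. \<Sum>\<sigma>\<in>UNIV. a $ \<rho> * b $ \<sigma> * fS \<rho> \<sigma>) *m S' x
    + (\<Sum>\<rho>\<in>UNIV. \<Sum>\<sigma>\<in>UNIV. a $ \<rho> * b $ \<sigma> * fM \<rho> \<sigma>) *m M x
    + (\<Sum>\<rho>\<in>UNIV. \<Sum>\<sigma>\<in>UNIV. a $ \<rho> * b $ \<sigma> * fT \<rho> \<sigma>) *m T' x"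
  unfolding field_strength_along_def field_strength_eq
  by (simp add: cmat2_eq_iff sum_distrib_right sum.distrib[symmetric] ring_distribs mult.assoc)

definition l' :: "4 \<Rightarrow> complex" where
  "l' \<rho> = (if \<rho> = 0 then lam * cnj mu + 1 else if \<rho> = 1 then lam * cnj mu - 1
     else if \<rho> = 2 then lam + cnj mu else \<i> * (lam - cnj mu))"

lemma l_eq: "l \<rho> = \<beta> / of_real (sqrt 2) * l' \<rho>"
  using all_4_from_0[of "\<lambda>\<rho>. l \<rho> = \<beta> / of_real (sqrt 2) * l' \<rho>"]
  by (simp add: l_0 l_1 l_2 l_3 l'_def)

lemma sqrt_2_complex: "complex_of_real (sqrt 2) * complex_of_real (sqrt 2) = 2"
  by (simp flip: of_real_mult)

text \<open>With \<open>\<beta>\<close> and the square roots pulled out, polynomials in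
  \<open>lam\<close>, \<open>mu\<close> and their conjugates remain.\<close>

lemma fS_eq: "fS \<rho> \<sigma> = - (k * \<beta>\<^sup>2 / 2) * (l' \<rho> * p' \<sigma> - l' \<sigma> * p' \<rho>)"
  and fT_eq: "fT \<rho> \<sigma> = - (k * (cnj \<beta>)\<^sup>2 / 2) * (cnj (l' \<rho>) * q' \<sigma> - cnj (l' \<sigma>) * q' \<rho>)"
  and fM_eq: "fM \<rho> \<sigma> = - (k * (\<beta> * cnj \<beta>) / 2) *
    (cnj (l' \<rho>) * p' \<sigma> - cnj (l' \<sigma>) * p' \<rho> + l' \<rho> * q' \<sigma> - l' \<sigma> * q' \<rho>
      - k * (p' \<rho> * q' \<sigma> - q' \<rho> * p' \<sigma>))"
proof -
  define r where "r = complex_of_real (sqrt 2)"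
  have "r \<noteq> 0" and [simp]: "cnj r = r" by (simp_all add: r_def)
  note r = sqrt_2_complex[folded r_def]
  \<comment> \<open>Factors carrying 1 / sqrt 2 are collected in pairs, so that
    \<open>r * r = 2\<close> removes the root.\<close>
  have r': "a / r * (b / r) = a * b / 2" for a b by (simp add: r)
  have "fS \<rho> \<sigma> = (\<beta> / r * (- k * \<beta> / r)) * (l' \<rho> * p' \<sigma> - l' \<sigma> * p' \<rho>)"
    unfolding fS_def p_def l_eq r_def[symmetric] by (simp only: algebra_simps)
  then show "fS \<rho> \<sigma> = - (k * \<beta>\<^sup>2 / 2) * (l' \<rho> * p' \<sigma> - l' \<sigma> * p' \<rho>)"
    unfolding r' by (simp add: field_simps power2_eq_square)
  have "fT \<rho> \<sigma> = (cnj \<beta> / r * (- k * cnj \<beta> / r)) * (cnj (l' \<rho>) * q' \<sigma> - cnj (l' \<sigma>) * q' \<rho>)"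
    unfolding fT_def q_def l_eq r_def[symmetric] complex_cnj_mult complex_cnj_divide \<open>cnj r = r\<close>
    by (simp only: algebra_simps)
  then show "fT \<rho> \<sigma> = - (k * (cnj \<beta>)\<^sup>2 / 2) * (cnj (l' \<rho>) * q' \<sigma> - cnj (l' \<sigma>) * q' \<rho>)"
    unfolding r' by (simp add: field_simps power2_eq_square)
  have fM: "fM \<rho> \<sigma> = (cnj \<beta> / r * (- k * \<beta> / r)) * (cnj (l' \<rho>) * p' \<sigma> - cnj (l' \<sigma>) * p' \<rho>)
    + (\<beta> / r * (- k * cnj \<beta> / r)) * (l' \<rho> * q' \<sigma> - l' \<sigma> * q' \<rho>)
    + (- k * \<beta> / r * (- k * cnj \<beta> / r)) * (p' \<rho> * q' \<sigma> - q' \<rho> * p' \<sigma>)"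
    unfolding fM_def p_def q_def l_eq r_def[symmetric] complex_cnj_mult complex_cnj_divide \<open>cnj r = r\<close>
    by (simp only: algebra_simps)
  show "fM \<rho> \<sigma> = - (k * (\<beta> * cnj \<beta>) / 2) *
    (cnj (l' \<rho>) * p' \<sigma> - cnj (l' \<sigma>) * p' \<rho> + l' \<rho> * q' \<sigma> - l' \<sigma> * q' \<rho>
      - k * (p' \<rho> * q' \<sigma> - q' \<rho> * p' \<sigma>))"
    unfolding fM r' by (simp add: field_simps)
qed

text \<open>Contracted with \<open>dzt\<close> or \<open>dwt\<close>, \<open>p'\<close> and
  \<open>q'\<close> vanish. Contracted with \<open>dz\<close> or \<open>dw\<close>,
  \<open>l'\<close> becomes \<open>lam\<close> times \<open>p'\<close> and its conjugate
  \<open>mu\<close> times \<open>q'\<close>; with \<open>k = lam - mu\<close> the commutator then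
  cancels the derivative terms of the zw-component.\<close>

lemma anti_self_dual: "anti_self_dual_YM A"
proof -
  \<comment> \<open>Every sum below is homogeneous of degree two in \<open>c\<close>, so the value 1
    / sqrt 2 can stay opaque.\<close>
  obtain c where c: "dz = cvec4 c c 0 0" "dzt = cvec4 c (- c) 0 0"
    "dw = cvec4 0 0 c (- \<i> * c)" "dwt = cvec4 0 0 c (\<i> * c)"
    by (rule that[of "1 / of_real (sqrt 2)"]) (simp_all add: dz_def dzt_def dw_def dwt_def)
  note f = c fS_eq fT_eq fM_eq l'_def p'_def q'_def cvec4_def
  have 1: "(\<Sum>\<rho>\<in>UNIV. \<Sum>\<sigma>\<in>UNIV. dz $ \<rho> * dw $ \<sigma> * fS \<rho> \<sigma>) = 0"
    "(\<Sum>\<rho>\<in>UNIV. \<Sum>\<sigma>\<in>UNIV. dz $ \<rho> * dw $ \<sigma> * fM \<rho> \<sigma>) = 0"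
    "(\<Sum>\<rho>\<in>UNIV. \<Sum>\<sigma>\<in>UNIV. dz $ \<rho> * dw $ \<sigma> * fT \<rho> \<sigma>) = 0"
    by (simp_all add: sum_4_from_0 f) (simp_all add: field_simps)
  have 2: "(\<Sum>\<rho>\<in>UNIV. \<Sum>\<sigma>\<in>UNIV. dzt $ \<rho> * dwt $ \<sigma> * fS \<rho> \<sigma>) = 0"
    "(\<Sum>\<rho>\<in>UNIV. \<Sum>\<sigma>\<in>UNIV. dzt $ \<rho> * dwt $ \<sigma> * fM \<rho> \<sigma>) = 0"
    "(\<Sum>\<rho>\<in>UNIV. \<Sum>\<sigma>\<in>UNIV. dzt $ \<rho> * dwt $ \<sigma> * fT \<rho> \<sigma>) = 0"
    by (simp_all add: sum_4_from_0 f) (simp_all add: field_simps)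
  have 3: "(\<Sum>\<rho>\<in>UNIV. \<Sum>\<sigma>\<in>UNIV. dz $ \<rho> * dzt $ \<sigma> * fS \<rho> \<sigma>)
      = (\<Sum>\<rho>\<in>UNIV. \<Sum>\<sigma>\<in>UNIV. dw $ \<rho> * dwt $ \<sigma> * fS \<rho> \<sigma>)"
    "(\<Sum>\<rho>\<in>UNIV. \<Sum>\<sigma>\<in>UNIV. dz $ \<rho> * dzt $ \<sigma> * fM \<rho> \<sigma>)
      = (\<Sum>\<rho>\<in>UNIV. \<Sum>\<sigma>\<in>UNIV. dw $ \<rho> * dwt $ \<sigma> * fM \<rho> \<sigma>)"
    "(\<Sum>\<rho>\<in>UNIV. \<Sum>\<sigma>\<in>UNIV. dz $ \<rho> * dzt $ \<sigma> * fT \<rho> \<sigma>)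
      = (\<Sum>\<rho>\<in>UNIV. \<Sum>\<sigma>\<in>UNIV. dw $ \<rho> * dwt $ \<sigma> * fT \<rho> \<sigma>)"
    by (simp_all add: sum_4_from_0 f) (simp_all add: field_simps)
  show ?thesis
    unfolding anti_self_dual_YM_def field_strength_along_eq 1 2 3
    by (simp add: cmat2_eq_iff)
qed

section \<open>Traces and the Lagrangian density\<close>

lemma field_strength_up_eq:
  "field_strength_up A \<rho> \<sigma> x = (minkowski \<rho> \<rho> * minkowski \<sigma> \<sigma>) *m field_strength A \<rho> \<sigma> x"
proof -
  define G where "G = (minkowski \<rho> \<rho> * minkowski \<sigma> \<sigma>) *m field_strength A \<rho> \<sigma> x"
  have "(minkowski \<rho> \<kappa> * minkowski \<sigma> \<tau>) *m field_strength A \<kappa> \<tau> x =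
    (if \<tau> = \<sigma> then if \<kappa> = \<rho> then G else 0 else 0)" for \<kappa> \<tau>
    by (auto simp: G_def minkowski_def cmat2_eq_iff)
  then have "field_strength_up A \<rho> \<sigma> x = G" unfolding field_strength_up_def by simp
  then show ?thesis by (simp add: G_def)
qed

lemma trace_A: "trace (A \<rho> x) = 0"
  by (simp add: A_eq S_def T_def trace_cmat2)

lemma S_scale: "S x = (2 * e0 / (D x)\<^sup>2) *m mat2 (cnj (u x) * cnj (v x)) (- cnj (v x) * cnj (v x))
    (cnj (u x) * cnj (u x)) (- cnj (u x) * cnj (v x))"
  and T_scale: "T x = (2 * cnj e0 / (D x)\<^sup>2) *m mat2 (u x * v x) (u x * u x)
    (- v x * v x) (- u x * v x)"
  by (simp_all add: S_def T_def cmat2_eq_iff)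

text \<open>Of the six traces two survive. \<open>S'\<close> and \<open>T'\<close> are nilpotent,
  and they are trace-orthogonal to \<open>M\<close>, a multiple of 1 - 2 \<open>P\<close>, because
  \<open>S\<close>, \<open>S ** P\<close>, \<open>T\<close> and \<open>T ** P\<close> are
  traceless.\<close>

lemma trace_field_strength_square:
  "trace (field_strength A \<rho> \<sigma> x ** field_strength A \<rho> \<sigma> x) =
    (32 * (e0 * cnj e0)\<^sup>2 / (D x) ^ 4) * (fM \<rho> \<sigma>)\<^sup>2
    + (32 * (e0 * cnj e0) * (D' x * cnj (D' x)) / (D x) ^ 4) * (fS \<rho> \<sigma> * fT \<rho> \<sigma>)"
proof -
  have expand: "trace ((s *m X + m *m Y + t *m Z) ** (s *m X + m *m Y + t *m Z))
    = s\<^sup>2 * trace (X ** X) + t\<^sup>2 * trace (Z ** Z) + m\<^sup>2 * trace (Y ** Y) + 2 * s * m * trace (X ** Y)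
      + 2 * m * t * trace (Z ** Y) + 2 * s * t * trace (X ** Z)" for s m t and X Y Z :: cmat2
    by (simp add: trace_cmat2 cmat2_mult_nth algebra_simps power2_eq_square)
  have tr: "trace (a *m X ** Y) = a * trace (X ** Y)" "trace (X ** a *m Y) = a * trace (X ** Y)"
    for a and X Y :: cmat2
    by (simp_all add: trace_cmat2 cmat2_mult_nth algebra_simps)
  have [simp]: "trace (S' x ** S' x) = 0" "trace (T' x ** T' x) = 0"
    unfolding S'_def T'_def tr S_mult_S T_mult_T by (simp_all add: trace_cmat2)
  have [simp]: "trace (S' x ** M x) = 0" "trace (T' x ** M x) = 0"
    unfolding S'_def T'_def M_def S_scale T_scale tr
    by (simp_all add: trace_cmat2 cmat2_mult_nth algebra_simps)
  have M: "trace (M x ** M x) = 32 * (e0 * cnj e0)\<^sup>2 / (D x) ^ 4"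
  proof -
    have "trace (M x ** M x) = 4 * e0 * cnj e0 / (D x) ^ 3 * (4 * e0 * cnj e0 / (D x) ^ 3 * (2 * (D x)\<^sup>2))"
      unfolding M_def tr
      by (simp add: trace_cmat2 cmat2_mult_nth power2_eq_square) (simp add: D_def algebra_simps)
    also have "\<dots> = 32 * (e0 * cnj e0)\<^sup>2 / (D x) ^ 4"
      using D_nonzero[of x] by (simp add: eval_nat_numeral mult_ac)
    finally show ?thesis .
  qed
  have ST: "trace (S' x ** T' x) = 16 * (e0 * cnj e0) * (D' x * cnj (D' x)) / (D x) ^ 4"
  proof -
    \<comment> \<open>The trace of a product of two rank-one matrices is the product of two
      row-column pairings, each equal to \<open>D x\<close>.\<close>
    have N: "trace (mat2 (cnj (u x) * cnj (v x)) (- cnj (v x) * cnj (v x)) (cnj (u x) * cnj (u x))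
        (- cnj (u x) * cnj (v x)) ** mat2 (u x * v x) (u x * u x) (- v x * v x) (- u x * v x)) = (D x)\<^sup>2"
      by (simp add: trace_cmat2 cmat2_mult_nth D_def algebra_simps power2_eq_square)
    have "trace (S' x ** T' x) = - 2 * cnj (D' x) / D x * (2 * cnj e0 / (D x)\<^sup>2
        * (- 2 * D' x / D x * (2 * e0 / (D x)\<^sup>2 * (D x)\<^sup>2)))"
      unfolding S'_def T'_def S_scale T_scale tr N by (rule refl)
    also have "\<dots> = 16 * (e0 * cnj e0) * (D' x * cnj (D' x)) / (D x) ^ 4"
      using D_nonzero[of x] by (simp add: eval_nat_numeral mult_ac)
    finally show ?thesis .
  qed
  show ?thesis
    unfolding field_strength_eq expand M ST by (simp add: mult_ac)
qed

lemma lagrangian_eq: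
  "lagrangian A x = 64 * ((\<beta> * k) * cnj (\<beta> * k))\<^sup>2 * (e0 * cnj e0)
      * (D' x * cnj (D' x) - 2 * (e0 * cnj e0)) / (D x) ^ 4"
proof -
  let ?g = "\<lambda>\<rho> \<sigma>. minkowski \<rho> \<rho> * minkowski \<sigma> \<sigma>"
  have tr: "trace ((F::cmat2) ** c *m G) = c * trace (F ** G)" for F G c
    by (simp add: trace_cmat2 cmat2_simps algebra_simps)
  \<comment> \<open>The values \<open>- 4 * N\<close> and \<open>2 * N\<close> are those of the two
    index contractions below, with N = |\<open>\<beta> * k\<close>|^4.\<close>
  have alg: "32 * E\<^sup>2 / d * (- 4 * N) + 32 * E * d' / d * (2 * N) = 64 * N * E * (d' - 2 * E) / d"
    for E N d d' :: complex
    by (simp add: divide_simps power2_eq_square algebra_simps)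
  \<comment> \<open>The factors that do not depend on the indices are kept as variables
    \<open>m\<close> and \<open>s\<close>, so that they are not expanded.\<close>
  have "lagrangian A x = (\<Sum>\<rho>\<in>UNIV. \<Sum>\<sigma>\<in>UNIV. m * (?g \<rho> \<sigma> * (fM \<rho> \<sigma>)\<^sup>2) + s * (?g \<rho> \<sigma> * (fS \<rho> \<sigma> * fT \<rho> \<sigma>)))"
    if "m = 32 * (e0 * cnj e0)\<^sup>2 / (D x) ^ 4" "s = 32 * (e0 * cnj e0) * (D' x * cnj (D' x)) / (D x) ^ 4"
    for m s
    unfolding lagrangian_def field_strength_up_eq tr trace_field_strength_square that[symmetric]
    by (simp only: algebra_simps)
  then have "lagrangian A x = 32 * (e0 * cnj e0)\<^sup>2 / (D x) ^ 4
        * (\<Sum>\<rho>\<in>UNIV. \<Sum>\<sigma>\<in>UNIV. ?g \<rho> \<sigma> * (fM \<rho> \<sigma>)\<^sup>2)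
      + 32 * (e0 * cnj e0) * (D' x * cnj (D' x)) / (D x) ^ 4
        * (\<Sum>\<rho>\<in>UNIV. \<Sum>\<sigma>\<in>UNIV. ?g \<rho> \<sigma> * (fS \<rho> \<sigma> * fT \<rho> \<sigma>))"
    by (simp only: sum_distrib_left sum.distrib)
  moreover have "(\<Sum>\<rho>\<in>UNIV. \<Sum>\<sigma>\<in>UNIV. ?g \<rho> \<sigma> * (fM \<rho> \<sigma>)\<^sup>2) = - 4 * ((\<beta> * k) * cnj (\<beta> * k))\<^sup>2"
  proof -
    let ?m = "\<lambda>\<rho> \<sigma>. cnj (l' \<rho>) * p' \<sigma> - cnj (l' \<sigma>) * p' \<rho> + l' \<rho> * q' \<sigma> - l' \<sigma> * q' \<rho>
      - k * (p' \<rho> * q' \<sigma> - q' \<rho> * p' \<sigma>)"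
    have sq: "g * (- (a / 2) * m)\<^sup>2 = (a\<^sup>2 / 4) * (g * m\<^sup>2)" for g a m :: complex
      by (simp add: power2_eq_square)
    \<comment> \<open>The metric signs enter here; the prefactor
      \<open>k\<^sup>2 * (\<beta> * cnj \<beta>)\<^sup>2 / 4\<close> of the squared
      \<open>fM\<close> turns - 16 into - 4.\<close>
    have "(\<Sum>\<rho>\<in>UNIV. \<Sum>\<sigma>\<in>UNIV. ?g \<rho> \<sigma> * (?m \<rho> \<sigma>)\<^sup>2) = - 16 * (cnj k)\<^sup>2"
      by (simp add: sum_4_from_0 l'_def p'_def q'_def minkowski_def)
        (simp add: power2_eq_square algebra_simps)
    then show ?thesis
      unfolding fM_eq sq sum_distrib_left[symmetric]
      by (simp add: power2_eq_square)
  qed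
  moreover have "(\<Sum>\<rho>\<in>UNIV. \<Sum>\<sigma>\<in>UNIV. ?g \<rho> \<sigma> * (fS \<rho> \<sigma> * fT \<rho> \<sigma>)) = 2 * ((\<beta> * k) * cnj (\<beta> * k))\<^sup>2"
  proof -
    have sq: "g * (- (a / 2) * m * (- (b / 2) * n)) = (a * b / 4) * (g * (m * n))"
      for g a b m n :: complex
      by simp
    have "(\<Sum>\<rho>\<in>UNIV. \<Sum>\<sigma>\<in>UNIV. ?g \<rho> \<sigma> * ((l' \<rho> * p' \<sigma> - l' \<sigma> * p' \<rho>)
        * (cnj (l' \<rho>) * q' \<sigma> - cnj (l' \<sigma>) * q' \<rho>))) = 8 * (cnj k)\<^sup>2"
      by (simp add: sum_4_from_0 l'_def p'_def q'_def minkowski_def)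
        (simp add: power2_eq_square algebra_simps)
    then show ?thesis
      unfolding fS_eq fT_eq sq sum_distrib_left[symmetric]
      by (simp add: power2_eq_square)
  qed
  ultimately show ?thesis
    using alg by (simp only:)
qed

section \<open>Passage to hyperbolic functions\<close>

abbreviation "\<epsilon>1 \<equiv> eps1 a1 b1"
abbreviation "\<epsilon>1t \<equiv> eps1 a2 b2"
abbreviation "\<epsilon>2 \<equiv> eps2 a1 a2 b1 b2"
abbreviation "X1 \<equiv> X1fun a1 a2 b1 b2 \<beta> lam mu"
abbreviation "X2 \<equiv> X2fun a1 a2 b1 b2 \<beta> lam mu"

lemma eps1_pos: "\<epsilon>1 > 0" "\<epsilon>1t > 0"
proof -
  have "a1 \<noteq> 0 \<or> b1 \<noteq> 0" "a2 \<noteq> 0 \<or> b2 \<noteq> 0" using eps0 by (auto simp: eps0_def)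
  then show "\<epsilon>1 > 0" "\<epsilon>1t > 0"
    by (auto simp: eps1_def intro: add_pos_nonneg add_nonneg_pos)
qed

lemma eps1_complex:
  "complex_of_real \<epsilon>1 = a1 * cnj a1 + b1 * cnj b1"
  "complex_of_real \<epsilon>1t = a2 * cnj a2 + b2 * cnj b2"
  by (simp_all add: eps1_def complex_norm_square del: of_real_power)

text \<open>Lagrange's identity for the vectors (a1, b1) and (a2, b2); for
  \<open>\<epsilon>2 = 0\<close> it identifies the geometric mean in the denominator with
  \<open>cmod e0\<close>.\<close>

lemma eps_Lagrange: "\<epsilon>1 * \<epsilon>1t = (cmod e0)\<^sup>2 + (cmod \<epsilon>2)\<^sup>2"
proof -
  have "complex_of_real (\<epsilon>1 * \<epsilon>1t) = complex_of_real ((cmod e0)\<^sup>2 + (cmod \<epsilon>2)\<^sup>2)"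
    unfolding of_real_mult of_real_add complex_norm_square eps1_complex
    by (simp add: eps0_def eps2_def algebra_simps)
  then show ?thesis by (simp only: of_real_eq_iff)
qed

text \<open>The logarithmic shift in \<open>X1\<close> replaces the unequal coefficients of the two
  exponentials by their geometric mean.\<close>

lemma exp_X1:
  "of_real (sqrt (\<epsilon>1 * \<epsilon>1t)) * exp (X1 x) = \<epsilon>1 * (exp (L x) * exp (cnj (L x)))"
  "of_real (sqrt (\<epsilon>1 * \<epsilon>1t)) * exp (- X1 x) = \<epsilon>1t * (exp (- L x) * exp (- cnj (L x)))"
proof -
  have r: "sqrt (\<epsilon>1 * \<epsilon>1t) * exp (ln (\<epsilon>1 / \<epsilon>1t) / 2) = \<epsilon>1"
    "sqrt (\<epsilon>1 * \<epsilon>1t) * exp (- (ln (\<epsilon>1 / \<epsilon>1t) / 2)) = \<epsilon>1t"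
  proof -
    have h: "exp (ln (\<epsilon>1 / \<epsilon>1t) / 2) = sqrt \<epsilon>1 / sqrt \<epsilon>1t"
      using eps1_pos by (simp add: ln_sqrt[symmetric] real_sqrt_divide)
    have p: "sqrt \<epsilon>1 * sqrt \<epsilon>1 = \<epsilon>1" "sqrt \<epsilon>1t * sqrt \<epsilon>1t = \<epsilon>1t" "sqrt \<epsilon>1 \<noteq> 0" "sqrt \<epsilon>1t \<noteq> 0"
      using eps1_pos by simp_all
    show "sqrt (\<epsilon>1 * \<epsilon>1t) * exp (ln (\<epsilon>1 / \<epsilon>1t) / 2) = \<epsilon>1"
      "sqrt (\<epsilon>1 * \<epsilon>1t) * exp (- (ln (\<epsilon>1 / \<epsilon>1t) / 2)) = \<epsilon>1t"
      unfolding exp_minus h real_sqrt_mult using p by simp_all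
  qed
  have "of_real (sqrt (\<epsilon>1 * \<epsilon>1t)) * exp (X1 x)
      = of_real (sqrt (\<epsilon>1 * \<epsilon>1t) * exp (ln (\<epsilon>1 / \<epsilon>1t) / 2)) * (exp (L x) * exp (cnj (L x)))"
    unfolding X1fun_def exp_add of_real_mult exp_of_real by (simp only: mult_ac)
  then show "of_real (sqrt (\<epsilon>1 * \<epsilon>1t)) * exp (X1 x) = \<epsilon>1 * (exp (L x) * exp (cnj (L x)))"
    unfolding r .
  have "of_real (sqrt (\<epsilon>1 * \<epsilon>1t)) * exp (- X1 x)
      = of_real (sqrt (\<epsilon>1 * \<epsilon>1t) * exp (- (ln (\<epsilon>1 / \<epsilon>1t) / 2))) * (exp (- L x) * exp (- cnj (L x)))"
    unfolding X1fun_def minus_add_distrib exp_add of_real_mult exp_of_real of_real_minus[symmetric]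
    by (simp only: mult_ac)
  then show "of_real (sqrt (\<epsilon>1 * \<epsilon>1t)) * exp (- X1 x) = \<epsilon>1t * (exp (- L x) * exp (- cnj (L x)))"
    unfolding r .
qed

text \<open>The shift in \<open>X2\<close> supplies the phase of \<open>\<epsilon>2\<close>. For
  \<open>\<epsilon>2 = 0\<close> both sides vanish, so the formulas built on this also serve the
  degenerate case.\<close>

lemma exp_X2:
  "of_real (cmod \<epsilon>2) * exp (X2 x) = \<epsilon>2 * (exp (L x) * exp (- cnj (L x)))"
  "of_real (cmod \<epsilon>2) * exp (- X2 x) = cnj \<epsilon>2 * (exp (- L x) * exp (cnj (L x)))"
proof -
  have r: "of_real (cmod \<epsilon>2) * exp (log_ratio_cnj \<epsilon>2 / 2) = \<epsilon>2"
    "of_real (cmod \<epsilon>2) * exp (- (log_ratio_cnj \<epsilon>2 / 2)) = cnj \<epsilon>2"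
  proof -
    show "of_real (cmod \<epsilon>2) * exp (log_ratio_cnj \<epsilon>2 / 2) = \<epsilon>2"
      by (cases "\<epsilon>2 = 0") (simp_all add: exp_log_ratio_cnj(2))
    \<comment> \<open>\<open>log_ratio_cnj\<close> is purely imaginary, so conjugation negates
      it.\<close>
    from arg_cong[OF this, of cnj]
    show "of_real (cmod \<epsilon>2) * exp (- (log_ratio_cnj \<epsilon>2 / 2)) = cnj \<epsilon>2"
      by (simp add: exp_cnj log_ratio_cnj_def)
  qed
  have "of_real (cmod \<epsilon>2) * exp (X2 x)
      = of_real (cmod \<epsilon>2) * exp (log_ratio_cnj \<epsilon>2 / 2) * (exp (L x) * exp (- cnj (L x)))"
    unfolding X2fun_def diff_conv_add_uminus exp_add by (simp only: mult_ac)
  then show "of_real (cmod \<epsilon>2) * exp (X2 x) = \<epsilon>2 * (exp (L x) * exp (- cnj (L x)))"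
    unfolding r .
  have "of_real (cmod \<epsilon>2) * exp (- X2 x)
      = of_real (cmod \<epsilon>2) * exp (- (log_ratio_cnj \<epsilon>2 / 2)) * (exp (- L x) * exp (cnj (L x)))"
    unfolding X2fun_def diff_conv_add_uminus minus_add_distrib minus_minus exp_add
    by (simp only: mult_ac)
  then show "of_real (cmod \<epsilon>2) * exp (- X2 x) = cnj \<epsilon>2 * (exp (- L x) * exp (cnj (L x)))"
    unfolding r .
qed

lemma cosh_sinh_X:
  "2 * (of_real (sqrt (\<epsilon>1 * \<epsilon>1t)) * cosh (X1 x)) =
    \<epsilon>1 * (exp (L x) * exp (cnj (L x))) + \<epsilon>1t * (exp (- L x) * exp (- cnj (L x)))"
  "2 * (of_real (sqrt (\<epsilon>1 * \<epsilon>1t)) * sinh (X1 x)) =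
    \<epsilon>1 * (exp (L x) * exp (cnj (L x))) - \<epsilon>1t * (exp (- L x) * exp (- cnj (L x)))"
  "2 * (of_real (cmod \<epsilon>2) * cosh (X2 x)) =
    \<epsilon>2 * (exp (L x) * exp (- cnj (L x))) + cnj \<epsilon>2 * (exp (- L x) * exp (cnj (L x)))"
  "2 * (of_real (cmod \<epsilon>2) * sinh (X2 x)) =
    \<epsilon>2 * (exp (L x) * exp (- cnj (L x))) - cnj \<epsilon>2 * (exp (- L x) * exp (cnj (L x)))"
  unfolding exp_X1[symmetric] exp_X2[symmetric]
  by (simp_all add: cosh_field_def sinh_field_def distrib_left right_diff_distrib)

lemma D_eq_cosh:
  "D x = 2 * (of_real (sqrt (\<epsilon>1 * \<epsilon>1t)) * cosh (X1 x) + of_real (cmod \<epsilon>2) * cosh (X2 x))"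
  unfolding distrib_left cosh_sinh_X
  unfolding eps1_complex D_def u_def v_def eps2_def
  by (simp add: exp_cnj algebra_simps)

text \<open>\<open>X1\<close> is real and \<open>X2\<close> imaginary, so conjugation flips only the
  second term, and \<open>D' x * cnj (D' x)\<close> is a difference of squares.\<close>

lemma D'_eq_sinh:
  "D' x = 2 * (of_real (sqrt (\<epsilon>1 * \<epsilon>1t)) * sinh (X1 x) + of_real (cmod \<epsilon>2) * sinh (X2 x))"
  "cnj (D' x) = 2 * (of_real (sqrt (\<epsilon>1 * \<epsilon>1t)) * sinh (X1 x) - of_real (cmod \<epsilon>2) * sinh (X2 x))"
  unfolding distrib_left right_diff_distrib cosh_sinh_X
  unfolding eps1_complex D'_def u_def v_def u'_def v'_def eps2_def
  by (simp_all add: exp_cnj algebra_simps)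

lemma lagrangian_Reals: "lagrangian A x \<in> \<real>"
proof -
  have "cnj (D x) = D x" by (simp add: D_def mult.commute)
  then have "cnj (lagrangian A x) = lagrangian A x"
    unfolding lagrangian_eq by (simp add: mult_ac)
  then show ?thesis by (simp add: Reals_cnj_iff)
qed

lemma of_real_sqrt_eps1: "(complex_of_real (sqrt (\<epsilon>1 * \<epsilon>1t)))\<^sup>2 = of_real (\<epsilon>1 * \<epsilon>1t)"
  using eps1_pos by (simp flip: of_real_power)

lemma lagrangian_cosh_sinh:
  "lagrangian A x = 8 * of_real (cmod (\<beta> * k) ^ 4 * (cmod e0)\<^sup>2)
    * ((2 * of_real (\<epsilon>1 * \<epsilon>1t) * (sinh (X1 x))\<^sup>2
        - 2 * of_real ((cmod \<epsilon>2)\<^sup>2) * (sinh (X2 x))\<^sup>2 - of_real ((cmod e0)\<^sup>2))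
       / (of_real (sqrt (\<epsilon>1 * \<epsilon>1t)) * cosh (X1 x) + of_real (cmod \<epsilon>2) * cosh (X2 x)) ^ 4)"
proof -
  have c4: "of_real (cmod z ^ 4) = (z * cnj z)\<^sup>2" for z
  proof -
    have "complex_of_real (cmod z ^ 4) = (of_real ((cmod z)\<^sup>2))\<^sup>2" by simp
    then show ?thesis unfolding complex_norm_square .
  qed
  \<comment> \<open>\<open>a\<close> and \<open>b\<close> stand for the sinh terms and
    \<open>c\<close> for the sum of the cosh terms; the constant is 64 * 2 / 2^4 = 8.\<close>
  have alg: "64 * N * E * (2 * (a + b) * (2 * (a - b)) - 2 * E) / (2 * c) ^ 4
      = 8 * (N * E) * ((2 * a\<^sup>2 - 2 * b\<^sup>2 - E) / c ^ 4)" for N E a b c :: complex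
    by (cases "c = 0") (simp_all add: divide_simps power_mult_distrib power2_eq_square algebra_simps)
  show ?thesis
    unfolding lagrangian_eq D_eq_cosh D'_eq_sinh(2)
    unfolding D'_eq_sinh(1) alg
    unfolding of_real_mult[of "_ ^ 4"] c4 cmod_e0 power_mult_distrib of_real_sqrt_eps1
    by (simp add: mult.assoc)
qed

lemma cosh_sum_nonzero:
  "of_real (sqrt (\<epsilon>1 * \<epsilon>1t)) * cosh (X1 x) + of_real (cmod \<epsilon>2) * cosh (X2 x) \<noteq> 0"
  using D_nonzero[of x] unfolding D_eq_cosh by (metis mult_zero_right)

lemma lagrangian_sech:
  assumes "\<epsilon>2 = 0"
  shows "lagrangian A x = 8 * of_real (cmod (\<beta> * k) ^ 4) * (2 * (sech (X1 x))\<^sup>2 - 3 * (sech (X1 x)) ^ 4)"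
proof -
  have e: "\<epsilon>1 * \<epsilon>1t = (cmod e0)\<^sup>2" using eps_Lagrange assms by simp
  have e': "complex_of_real (cmod e0) \<noteq> 0" using eps0 by simp
  have ch: "cosh (X1 x) \<noteq> 0" using cosh_sum_nonzero[of x] assms by auto
  \<comment> \<open>All powers of \<open>E = cmod e0\<close> cancel, and
    \<open>2 * s\<^sup>2 - 1 = 2 * c\<^sup>2 - 3\<close> for s = sinh and c = cosh.\<close>
  have alg: "8 * (N * E\<^sup>2) * ((2 * E\<^sup>2 * s\<^sup>2 - E\<^sup>2) / (E * c) ^ 4) = 8 * N * (2 * (1 / c)\<^sup>2 - 3 * (1 / c) ^ 4)"
    if "c\<^sup>2 = s\<^sup>2 + 1" "c \<noteq> 0" "E \<noteq> 0" for N E s c :: complex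
  proof -
    have "s\<^sup>2 = c\<^sup>2 - 1" using that by simp
    then show ?thesis using that by (simp add: divide_simps) algebra
  qed
  show ?thesis
    using alg[OF cosh_square_eq[of "X1 x"] ch e', of "of_real (cmod (\<beta> * k) ^ 4)"]
    unfolding lagrangian_cosh_sinh e assms sech_def by simp
qed

end

theorem mainTheorem3:
  fixes a1 a2 b1 b2 \<beta> lam mu :: complex
  assumes "lam * mu \<noteq> 0"
    and "eps0 a1 a2 b1 b2 \<noteq> 0"
  defines "L \<equiv> Lfun \<beta> lam mu"
    and "\<psi> \<equiv> psi a1 a2 b1 b2 \<beta> lam mu"
    and "J \<equiv> Jfun a1 a2 b1 b2 \<beta> lam mu"
    and "A \<equiv> gauge_field (Jfun a1 a2 b1 b2 \<beta> lam mu)"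
    and "\<epsilon>0 \<equiv> eps0 a1 a2 b1 b2"
    and "\<epsilon>1 \<equiv> eps1 a1 b1"
    and "\<epsilon>1t \<equiv> eps1 a2 b2"
    and "\<epsilon>2 \<equiv> eps2 a1 a2 b1 b2"
    and "X1 \<equiv> X1fun a1 a2 b1 b2 \<beta> lam mu"
    and "X2 \<equiv> X2fun a1 a2 b1 b2 \<beta> lam mu"
  shows
    "(\<forall>x. invertible (\<psi> x) \<and> invertible (J x) \<and> J differentiable (at x)
        \<and> (\<forall>\<rho>. A \<rho> differentiable (at x)))
     \<and> anti_self_dual_YM A
     \<and> (\<forall>\<rho> x. trace (A \<rho> x) = 0)
     \<and> (\<forall>x. lagrangian A x \<in> \<real>)
     \<and> (\<epsilon>2 \<noteq> 0 \<longrightarrow> (\<forall>x.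
          of_real (sqrt (\<epsilon>1 * \<epsilon>1t)) * cosh (X1 x) + of_real (cmod \<epsilon>2) * cosh (X2 x) \<noteq> 0
          \<and> lagrangian A x =
              8 * of_real (cmod (\<beta> * (lam - mu)) ^ 4 * (cmod \<epsilon>0)\<^sup>2)
              * ((2 * of_real (\<epsilon>1 * \<epsilon>1t) * (sinh (X1 x))\<^sup>2
                  - 2 * of_real ((cmod \<epsilon>2)\<^sup>2) * (sinh (X2 x))\<^sup>2 - of_real ((cmod \<epsilon>0)\<^sup>2))
                 / (of_real (sqrt (\<epsilon>1 * \<epsilon>1t)) * cosh (X1 x)
                    + of_real (cmod \<epsilon>2) * cosh (X2 x)) ^ 4)))
     \<and> (\<epsilon>2 = 0 \<longrightarrow> (\<forall>x.
          of_real (sqrt (\<epsilon>1 * \<epsilon>1t)) * cosh (X1 x) \<noteq> 0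
          \<and> lagrangian A x =
              8 * of_real (cmod (\<beta> * (lam - mu)) ^ 4 * (cmod \<epsilon>0)\<^sup>2)
              * ((2 * of_real (\<epsilon>1 * \<epsilon>1t) * (sinh (X1 x))\<^sup>2 - of_real ((cmod \<epsilon>0)\<^sup>2))
                 / (of_real (sqrt (\<epsilon>1 * \<epsilon>1t)) * cosh (X1 x)) ^ 4)
          \<and> (let X = L x + cnj (L x)
                 + of_real (ln (((cmod a1)\<^sup>2 + (cmod b1)\<^sup>2) / ((cmod a2)\<^sup>2 + (cmod b2)\<^sup>2)) / 2)
             in lagrangian A x =
                8 * of_real (cmod (\<beta> * (lam - mu)) ^ 4) * (2 * (sech X)\<^sup>2 - 3 * (sech X) ^ 4))))"
proof -
  interpret soliton a1 a2 b1 b2 \<beta> lam mu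
    by standard (use assms(1,2) in auto)
  note defs = assms(3-)
  show ?thesis
    \<comment> \<open>Folds the explicit squared moduli inside the logarithm back into
      \<open>eps1\<close>, matching \<open>X1fun\<close>.\<close>
    unfolding Let_def eps1_def[symmetric]
  proof (intro conjI allI impI)
    fix x
    show "invertible (\<psi> x)" unfolding defs by (rule invertible_psi)
    show "invertible (J x)" unfolding defs by (rule invertible_J)
    show "J differentiable (at x)" unfolding defs by (rule differentiableI[OF has_derivative_J])
    show "A \<rho> differentiable (at x)" for \<rho>
      unfolding defs by (rule differentiableI[OF has_derivative_A])
    show "anti_self_dual_YM A" unfolding defs by (rule anti_self_dual)
    show "trace (A \<rho> x) = 0" for \<rho> unfolding defs by (rule trace_A)
    show "lagrangian A x \<in> \<real>" unfolding defs by (rule lagrangian_Reals)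
    \<comment> \<open>This fact and the next are specialised below to
      \<open>\<epsilon>2 = 0\<close>, where the \<open>X2\<close> terms drop out.\<close>
    show nonzero: "of_real (sqrt (\<epsilon>1 * \<epsilon>1t)) * cosh (X1 x) + of_real (cmod \<epsilon>2) * cosh (X2 x) \<noteq> 0"
      unfolding defs by (rule cosh_sum_nonzero)
    show general: "lagrangian A x = 8 * of_real (cmod (\<beta> * (lam - mu)) ^ 4 * (cmod \<epsilon>0)\<^sup>2)
      * ((2 * of_real (\<epsilon>1 * \<epsilon>1t) * (sinh (X1 x))\<^sup>2
          - 2 * of_real ((cmod \<epsilon>2)\<^sup>2) * (sinh (X2 x))\<^sup>2 - of_real ((cmod \<epsilon>0)\<^sup>2))
        / (of_real (sqrt (\<epsilon>1 * \<epsilon>1t)) * cosh (X1 x) + of_real (cmod \<epsilon>2) * cosh (X2 x)) ^ 4)"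
      unfolding defs by (rule lagrangian_cosh_sinh)
    assume "\<epsilon>2 = 0"
    then show "of_real (sqrt (\<epsilon>1 * \<epsilon>1t)) * cosh (X1 x) \<noteq> 0"
      using nonzero by simp
    show "lagrangian A x = 8 * of_real (cmod (\<beta> * (lam - mu)) ^ 4 * (cmod \<epsilon>0)\<^sup>2)
      * ((2 * of_real (\<epsilon>1 * \<epsilon>1t) * (sinh (X1 x))\<^sup>2 - of_real ((cmod \<epsilon>0)\<^sup>2))
        / (of_real (sqrt (\<epsilon>1 * \<epsilon>1t)) * cosh (X1 x)) ^ 4)"
      using general \<open>\<epsilon>2 = 0\<close> by simp
    show "lagrangian A x = 8 * of_real (cmod (\<beta> * (lam - mu)) ^ 4)
      * (2 * (sech (L x + cnj (L x) + of_real (ln (eps1 a1 b1 / eps1 a2 b2) / 2)))\<^sup>2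
        - 3 * (sech (L x + cnj (L x) + of_real (ln (eps1 a1 b1 / eps1 a2 b2) / 2))) ^ 4)"
      using lagrangian_sech[of x] \<open>\<epsilon>2 = 0\<close> unfolding defs by (simp only: X1fun_def add.commute)
  qed
qed

end
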